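(* For all $k\geq1$, $$\mathcal{D}_{12\mbox{-}3\mbox{-}\ldots\mbox{-} k}(x)=\mathcal{D}_{1\mbox{-}2\mbox{-}3\mbox{-}\ldots\mbox{-} k}(x)=F_k(x)+xF_{k-1}(x).$$
   Context: A permutation $\pi$ is a Dumont permutation (of the first kind) if each even integer in $\pi$ is followed by a smaller integer, and each odd integer is either followed by a larger integer or is the last element of $\pi$. Generalized patterns: dashes between letters allow arbitrary gaps, while letters written adjacently (as $12$ in $12\mbox{-}3\mbox{-}\cdots\mbox{-}k$) must be adjacent in the permutation; $1\mbox{-}2\mbox{-}\cdots\mbox{-}k$ is the classical pattern $12\cdots k$. For a (generalized) pattern $\tau$, $\mathcal{D}_\tau(x)=\sum_{n\geq0}\mathcal{D}_\tau(n)x^n$ where $\mathcal{D}_\tau(n)$ is the number of Dumont permutations of length $n$ avoiding $1\mbox{-}3\mbox{-}2$ and $\tau$. For $r\geq2$ consider $Q_r(x)=1+\frac{x^2Q_{r-1}(x)}{1-x^2Q_{r-2}(x)}$; $F_r(x)$ is its solution with $Q_0=0$, $Q_1=1$. *)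

theory Defs
  imports
    "HOL-Combinatorics.Multiset_Permutations"
    "HOL-Computational_Algebra.Formal_Power_Series"
begin

text \<open>
  A permutation of length \<open>n\<close> is a word in \<open>permutations_of_set {1..n}\<close>; the parity
  condition refers to the actual letters.
\<close>

definition dumont :: "nat list \<Rightarrow> bool" where
  "dumont w \<longleftrightarrow> (\<forall>i < length w.
     (even (w ! i) \<longrightarrow> Suc i < length w \<and> w ! Suc i < w ! i) \<and>
     (odd (w ! i) \<longrightarrow> Suc i = length w \<or> w ! i < w ! Suc i))"

definition order_isomorphic :: "nat list \<Rightarrow> nat list \<Rightarrow> bool" where
  "order_isomorphic u v \<longleftrightarrow> length u = length v \<and>
     (\<forall>i < length u. \<forall>j < length u. u ! i < u ! j \<longleftrightarrow> v ! i < v ! j)"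

text \<open>
  A generalized pattern is the list of its dash-separated blocks, so \<open>12-3\<close> is
  \<open>[[1, 2], [3]]\<close> and a classical pattern has only singleton blocks.  An occurrence is given
  by the positions (counted from 0) of its letters, grouped into the same blocks.
\<close>

type_synonym gen_pattern = "nat list list"

definition pattern_occurrence :: "gen_pattern \<Rightarrow> nat list \<Rightarrow> nat list list \<Rightarrow> bool" where
  "pattern_occurrence p w I \<longleftrightarrow>
     map length I = map length p \<and>
     (\<forall>B \<in> set I. successively (\<lambda>i j. j = Suc i) B) \<and>
     sorted_wrt (<) (concat I) \<and>
     (\<forall>i \<in> set (concat I). i < length w) \<and>
     order_isomorphic (map (\<lambda>i. w ! i) (concat I)) (concat p)"

definition avoids :: "nat list \<Rightarrow> gen_pattern \<Rightarrow> bool" where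
  "avoids w p \<longleftrightarrow> \<not> (\<exists>I. pattern_occurrence p w I)"

definition pattern_132 :: gen_pattern where
  "pattern_132 = [[1], [3], [2]]"

definition classical_increasing :: "nat \<Rightarrow> gen_pattern" where
  "classical_increasing k = map (\<lambda>i. [i]) [1..<Suc k]"

text \<open>
  The pattern \<open>12-3-...-k\<close>.  For \<open>k = 1\<close> the first block is truncated and this is the
  pattern \<open>1\<close>.
\<close>

definition adjacent_increasing :: "nat \<Rightarrow> gen_pattern" where
  "adjacent_increasing k = take 2 [1..<Suc k] # map (\<lambda>i. [i]) [3..<Suc k]"

definition dumont_count :: "gen_pattern \<Rightarrow> nat \<Rightarrow> nat" where
  "dumont_count p n =
     card {w \<in> permutations_of_set {1..n}. dumont w \<and> avoids w pattern_132 \<and> avoids w p}"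

definition dumont_gf :: "gen_pattern \<Rightarrow> rat fps" where
  "dumont_gf p = Abs_fps (\<lambda>n. of_nat (dumont_count p n))"

text \<open>The denominator has constant coefficient 1, so this is genuine division of power series.\<close>

fun F :: "nat \<Rightarrow> rat fps" where
  "F 0 = 0"
| "F (Suc 0) = 1"
| "F (Suc (Suc r)) = 1 + (fps_X\<^sup>2 * F (Suc r)) / (1 - fps_X\<^sup>2 * F r)"

end

theory Submission
  imports Defs "HOL-Library.Sublist"
begin

text \<open>
  A 132-avoiding permutation of length \<open>N\<close> has the form \<open>u N v\<close> with every letter of \<open>u\<close> above
  every letter of \<open>v\<close>.  It is Dumont iff \<open>u\<close> and \<open>v\<close> are and \<open>v\<close> is nonempty exactly for even
  \<open>N\<close>, and it contains \<open>1-2-...-(k+1)\<close> iff \<open>u\<close> contains \<open>1-2-...-k\<close> or \<open>v\<close> contains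
  \<open>1-2-...-(k+1)\<close>.  If \<open>N\<close> is odd then \<open>v\<close> is empty; if \<open>N\<close> is even then either \<open>u\<close> is empty or
  \<open>v\<close> has even length.  Writing \<open>E\<^sub>k\<close> for the even part of the generating function, the odd part
  is therefore \<open>x E\<^bsub>k-1\<^esub>\<close> and \<open>E\<^sub>k - 1 = x\<^sup>2 E\<^bsub>k-1\<^esub> + x\<^sup>2 E\<^bsub>k-2\<^esub> (E\<^sub>k - 1)\<close>, which is the
  recurrence of \<open>F\<^sub>k\<close>.
\<close>

section \<open>Occurrences of patterns as subsequences\<close>

definition has_increasing :: "nat \<Rightarrow> nat list \<Rightarrow> bool" where
  "has_increasing k w \<longleftrightarrow> (\<exists>s. subseq s w \<and> length s = k \<and> sorted_wrt (<) s)"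

definition avoids_132 :: "nat list \<Rightarrow> bool" where
  "avoids_132 w \<longleftrightarrow> (\<forall>a b c. subseq [a, b, c] w \<longrightarrow> \<not> (a < c \<and> c < b))"

lemma subseq_set_subset: "subseq s w \<Longrightarrow> set s \<subseteq> set w"
  by (auto elim: list_emb_set)

text \<open>\<open>pattern_occurrence\<close> speaks of positions, whereas \<open>subseq\<close>
  splits well over concatenation. This and \<open>subseq_obtains_indices\<close> translate between
  the two.\<close>

lemma subseq_map_nth:
  assumes "sorted_wrt (<) is" "\<forall>i\<in>set is. i < length w"
  shows "subseq (map (\<lambda>i. w ! i) is) w"
  using assms
proof (induction w arbitrary: "is")
  case Nil
  then show ?case by (cases "is") auto
next
  case (Cons x w)
  \<comment> \<open>Positions that avoid the head of \<open>x # w\<close> are positions of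
    \<open>w\<close> after subtracting 1.\<close>
  have shift: "subseq (map (\<lambda>i. (x # w) ! i) js) w"
    if js: "sorted_wrt (<) js" "\<forall>j\<in>set js. 0 < j \<and> j < length (x # w)" for js
  proof -
    have "subseq (map (\<lambda>i. w ! i) (map (\<lambda>j. j - 1) js)) w"
    proof (rule Cons.IH)
      show "sorted_wrt (<) (map (\<lambda>j. j - 1) js)"
        using js unfolding sorted_wrt_map
        by (intro sorted_wrt_mono_rel[OF _ js(1)]) (auto simp: less_diff_conv)
    qed (use js in fastforce)
    moreover have "map (\<lambda>i. w ! i) (map (\<lambda>j. j - 1) js) = map (\<lambda>i. (x # w) ! i) js"
      using js(2) by (auto simp: nth_Cons')
    ultimately show ?thesis by metis
  qed
  show ?case
  proof (cases "\<exists>js. is = 0 # js")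
    case True
    then obtain js where js: "is = 0 # js" by blast
    have "subseq (map (\<lambda>i. (x # w) ! i) js) w"
      using Cons.prems js by (intro shift) auto
    then show ?thesis using js by simp
  next
    case False
    have "\<forall>j\<in>set is. 0 < j"
    proof (cases "is")
      case (Cons i js)
      then show ?thesis using False Cons.prems(1) by auto
    qed auto
    then have "subseq (map (\<lambda>i. (x # w) ! i) is) w"
      using Cons.prems by (intro shift) auto
    then show ?thesis by (rule list_emb_Cons)
  qed
qed

lemma subseq_obtains_indices:
  assumes "subseq s w"
  obtains "is" where "sorted_wrt (<) is" "\<forall>i\<in>set is. i < length w" "s = map (\<lambda>i. w ! i) is"
proof -
  have "\<exists>is. sorted_wrt (<) is \<and> (\<forall>i\<in>set is. i < length w) \<and> s = map (\<lambda>i. w ! i) is"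
    using assms
  proof (induction rule: list_emb.induct)
    case (list_emb_Nil ys)
    then show ?case by (intro exI[of _ "[]"]) auto
  next
    case (list_emb_Cons xs ys y)
    then obtain "is" where "sorted_wrt (<) is" "\<forall>i\<in>set is. i < length ys" "xs = map (\<lambda>i. ys ! i) is"
      by blast
    then show ?case by (intro exI[of _ "map Suc is"]) (auto simp: sorted_wrt_map)
  next
    case (list_emb_Cons2 x y xs ys)
    then obtain "is" where "sorted_wrt (<) is" "\<forall>i\<in>set is. i < length ys" "xs = map (\<lambda>i. ys ! i) is"
      by blast
    then show ?case using list_emb_Cons2
      by (intro exI[of _ "0 # map Suc is"]) (auto simp: sorted_wrt_map)
  qed
  then show thesis using that by blast
qed

lemma concat_map_singleton: "concat (map (\<lambda>i. [i]) xs) = xs"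
  by (induction xs) auto

text \<open>With singleton blocks the adjacency condition is vacuous, so only the increasing order
  of the positions remains.\<close>

lemma avoids_classical_iff:
  "avoids w (map (\<lambda>i. [i]) p) \<longleftrightarrow> \<not> (\<exists>s. subseq s w \<and> order_isomorphic s p)"
proof -
  have "(\<exists>I. pattern_occurrence (map (\<lambda>i. [i]) p) w I) \<longleftrightarrow> (\<exists>s. subseq s w \<and> order_isomorphic s p)"
  proof
    assume "\<exists>I. pattern_occurrence (map (\<lambda>i. [i]) p) w I"
    then show "\<exists>s. subseq s w \<and> order_isomorphic s p"
      unfolding pattern_occurrence_def concat_map_singleton using subseq_map_nth by blast
  next
    assume "\<exists>s. subseq s w \<and> order_isomorphic s p"
    then obtain s where s: "subseq s w" "order_isomorphic s p" by blast
    from s(1) obtain "is" where idx: "sorted_wrt (<) is" "\<forall>i\<in>set is. i < length w"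
      "s = map (\<lambda>i. w ! i) is" by (rule subseq_obtains_indices)
    have len: "length is = length p" using s(2) idx(3) by (simp add: order_isomorphic_def)
    have "pattern_occurrence (map (\<lambda>i. [i]) p) w (map (\<lambda>i. [i]) is)"
      unfolding pattern_occurrence_def concat_map_singleton
      using idx s(2) len by (auto simp: comp_def map_replicate_const)
    then show "\<exists>I. pattern_occurrence (map (\<lambda>i. [i]) p) w I" by blast
  qed
  then show ?thesis by (simp add: avoids_def)
qed

text \<open>The \<open>i\<close>-th entry of \<open>[1..<Suc k]\<close> is \<open>Suc i\<close>, so
  order isomorphism means that comparing two letters amounts to comparing their positions.\<close>

lemma order_isomorphic_upt_iff:
  "order_isomorphic s [1..<Suc k] \<longleftrightarrow> length s = k \<and> sorted_wrt (<) s"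
proof
  assume "order_isomorphic s [1..<Suc k]"
  then show "length s = k \<and> sorted_wrt (<) s"
    by (auto simp: order_isomorphic_def sorted_wrt_iff_nth_less simp del: upt_Suc)
next
  assume s: "length s = k \<and> sorted_wrt (<) s"
  have "s ! i < s ! j \<longleftrightarrow> i < j" if "i < k" "j < k" for i j
    using s that sorted_wrt_nth_less[of "(<)" s i j] sorted_wrt_nth_less[of "(<)" s j i]
    by (cases i j rule: linorder_cases) auto
  then show "order_isomorphic s [1..<Suc k]"
    using s by (auto simp: order_isomorphic_def simp del: upt_Suc)
qed

lemma avoids_classical_increasing_iff:
  "avoids w (classical_increasing k) \<longleftrightarrow> \<not> has_increasing k w"
  unfolding classical_increasing_def avoids_classical_iff order_isomorphic_upt_iff
    has_increasing_def by blast

lemma order_isomorphic_132_iff: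
  "order_isomorphic s [1, 3, 2] \<longleftrightarrow> (\<exists>a b c. s = [a, b, c] \<and> a < c \<and> c < b)"
proof
  assume s: "order_isomorphic s [1, 3, 2]"
  then have "length s = Suc (Suc (Suc 0))" by (simp add: order_isomorphic_def)
  then obtain a b c where abc: "s = [a, b, c]" by (auto simp: length_Suc_conv)
  have "s ! 0 < s ! 2" "s ! 2 < s ! 1"
    using s unfolding order_isomorphic_def abc by force+
  then show "\<exists>a b c. s = [a, b, c] \<and> a < c \<and> c < b" using abc by auto
next
  assume "\<exists>a b c. s = [a, b, c] \<and> a < c \<and> c < b"
  then show "order_isomorphic s [1, 3, 2]"
    by (auto simp: order_isomorphic_def less_Suc_eq)
qed

lemma avoids_pattern_132_iff: "avoids w pattern_132 \<longleftrightarrow> avoids_132 w"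
proof -
  have "pattern_132 = map (\<lambda>i. [i]) [1, 3, 2]" by (simp add: pattern_132_def)
  then show ?thesis
    unfolding avoids_132_def
    by (metis (no_types, lifting) avoids_classical_iff order_isomorphic_132_iff)
qed

section \<open>The pattern with an adjacent pair against the classical one\<close>

lemma adjacent_increasing_Suc_Suc:
  "adjacent_increasing (Suc (Suc k)) = [1, 2] # map (\<lambda>i. [i]) [3..<Suc (Suc (Suc k))]"
  by (simp add: adjacent_increasing_def upt_conv_Cons numeral_eq_Suc del: upt_Suc)

lemma concat_adjacent_increasing:
  "concat (adjacent_increasing (Suc (Suc k))) = [1..<Suc (Suc (Suc k))]"
  unfolding adjacent_increasing_Suc_Suc concat.simps concat_map_singleton
  by (simp add: upt_conv_Cons numeral_eq_Suc del: upt_Suc)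

text \<open>
  In a 132-avoiding word all letters between the first two letters of an increasing subsequence
  are smaller than the second one, so the first letter can be moved next to the second.
\<close>

lemma avoids_adjacent_increasing_iff:
  assumes "distinct w" "avoids_132 w" "k \<ge> 1"
  shows "avoids w (adjacent_increasing k) \<longleftrightarrow> \<not> has_increasing k w"
proof (cases "k = 1")
  case True
  then have "adjacent_increasing k = classical_increasing k"
    by (simp add: adjacent_increasing_def classical_increasing_def)
  then show ?thesis by (simp add: avoids_classical_increasing_iff)
next
  case False
  with assms(3) obtain l where k: "k = Suc (Suc l)"
    by (intro that[of "k - 2"]) auto
  have "(\<exists>I. pattern_occurrence (adjacent_increasing k) w I) \<longleftrightarrow> has_increasing k w"
  proof
    assume "\<exists>I. pattern_occurrence (adjacent_increasing k) w I"
    then show "has_increasing k w"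
      unfolding pattern_occurrence_def k concat_adjacent_increasing order_isomorphic_upt_iff
        has_increasing_def using subseq_map_nth by blast
  next
    assume "has_increasing k w"
    then obtain s where s: "subseq s w" "length s = k" "sorted_wrt (<) s"
      unfolding has_increasing_def by blast
    from s(1) obtain "is" where idx: "sorted_wrt (<) is" "\<forall>i\<in>set is. i < length w"
      "s = map (\<lambda>i. w ! i) is" by (rule subseq_obtains_indices)
    have "length is = Suc (Suc l)" using s(2) idx(3) k by simp
    then obtain i j r where r: "is = i # j # r" "length r = l"
      by (auto simp: length_Suc_conv)
    have ij: "i < j" "j < length w" "\<forall>x\<in>set r. j < x \<and> x < length w" "sorted_wrt (<) r"
      using idx r by auto
    have ws: "w ! i < w ! j" "\<forall>x\<in>set r. w ! j < w ! x" "sorted_wrt (<) (map (\<lambda>i. w ! i) r)"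
      using s(3) idx(3) r by auto
    \<comment> \<open>The position just before \<open>j\<close>, which replaces \<open>i\<close> as
      the start of the occurrence; it may equal \<open>i\<close>.\<close>
    define h where "h = j - 1"
    have h: "j = Suc h" "i \<le> h" using ij by (auto simp: h_def)
    have wh: "w ! h < w ! j"
    proof (cases "i = h")
      case False
      then have "subseq (map (\<lambda>i. w ! i) [i, h, j]) w"
        using h ij by (intro subseq_map_nth) auto
      \<comment> \<open>Otherwise the letters at \<open>i\<close>, \<open>h\<close>,
        \<open>j\<close> would form a 132.\<close>
      then have "\<not> w ! j < w ! h" using assms(2) ws(1) unfolding avoids_132_def by fastforce
      moreover have "w ! h \<noteq> w ! j" using assms(1) h ij by (simp add: nth_eq_iff_index_eq)
      ultimately show ?thesis by simp
    qed (use ws in simp)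
    have "pattern_occurrence (adjacent_increasing k) w ([h, j] # map (\<lambda>i. [i]) r)"
      unfolding pattern_occurrence_def k concat_adjacent_increasing order_isomorphic_upt_iff
    proof (intro conjI)
      show "map length ([h, j] # map (\<lambda>i. [i]) r) = map length (adjacent_increasing (Suc (Suc l)))"
        using r by (simp add: adjacent_increasing_Suc_Suc comp_def map_replicate_const del: upt_Suc)
      show "\<forall>B\<in>set ([h, j] # map (\<lambda>i. [i]) r). successively (\<lambda>i j. j = Suc i) B"
        using h by auto
      show "sorted_wrt (<) (concat ([h, j] # map (\<lambda>i. [i]) r))"
        using ij h by (auto simp: concat_map_singleton)
      show "\<forall>i\<in>set (concat ([h, j] # map (\<lambda>i. [i]) r)). i < length w"
        using ij h by (auto simp: concat_map_singleton)
      show "length (map ((!) w) (concat ([h, j] # map (\<lambda>i. [i]) r))) = Suc (Suc l)"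
        using r by (simp add: concat_map_singleton)
      show "sorted_wrt (<) (map ((!) w) (concat ([h, j] # map (\<lambda>i. [i]) r)))"
        using wh ws by (auto simp: concat_map_singleton)
    qed
    then show "\<exists>I. pattern_occurrence (adjacent_increasing k) w I" by blast
  qed
  then show ?thesis by (simp add: avoids_def)
qed

section \<open>Splitting a word at its greatest letter\<close>

lemma dumont_iff_successively:
  "dumont w \<longleftrightarrow> successively (\<lambda>x y. if even x then y < x else x < y) w \<and> (w = [] \<or> odd (last w))"
  (is "_ \<longleftrightarrow> successively ?R w \<and> _")
proof
  assume d: "dumont w"
  have "successively ?R w"
    unfolding successively_conv_nth
  proof (intro allI impI)
    fix i assume "Suc i < length w"
    moreover from this have "i < length w" "Suc i \<noteq> length w" by auto
    ultimately show "?R (w ! i) (w ! Suc i)" using d unfolding dumont_def by metis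
  qed
  moreover have "odd (last w)" if "w \<noteq> []"
  proof -
    have "length w - 1 < length w" "\<not> Suc (length w - 1) < length w" using that by auto
    then show ?thesis using d that unfolding dumont_def last_conv_nth[OF that] by blast
  qed
  ultimately show "successively ?R w \<and> (w = [] \<or> odd (last w))" by blast
next
  assume w: "successively ?R w \<and> (w = [] \<or> odd (last w))"
  show "dumont w"
    unfolding dumont_def
  proof (intro allI impI)
    fix i assume i: "i < length w"
    show "(even (w ! i) \<longrightarrow> Suc i < length w \<and> w ! Suc i < w ! i) \<and>
     (odd (w ! i) \<longrightarrow> Suc i = length w \<or> w ! i < w ! Suc i)"
    proof (cases "Suc i < length w")
      case True
      then show ?thesis using w by (auto simp: successively_conv_nth split: if_splits)
    next
      case False
      then have "i = length w - 1" using i by simp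
      then show ?thesis using w i by (cases "w = []") (auto simp: last_conv_nth)
    qed
  qed
qed

text \<open>The last letter of \<open>u\<close> is followed by the larger \<open>N\<close>, so it
  must be odd, just as when it ends a Dumont word. The letter \<open>N\<close> itself is followed by
  a smaller letter if \<open>v\<close> is nonempty and is last otherwise, which fixes its
  parity.\<close>

lemma dumont_append_greatest:
  assumes "\<forall>x\<in>set u. x < N" "\<forall>x\<in>set v. x < N"
  shows "dumont (u @ N # v) \<longleftrightarrow> dumont u \<and> dumont v \<and> (even N \<longleftrightarrow> v \<noteq> [])"
proof -
  have "u \<noteq> [] \<longrightarrow> last u < N" "v \<noteq> [] \<longrightarrow> hd v < N" using assms by auto
  then show ?thesis
    by (auto simp: dumont_iff_successively successively_append_iff successively_Cons)
qed

lemma dumont_map_add_even: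
  assumes "even j"
  shows "dumont (map (\<lambda>x. x + j) u) \<longleftrightarrow> dumont u"
  using assms by (auto simp: dumont_iff_successively successively_map last_map)

lemma not_dumont_least_even:
  assumes "x \<in> set u" "even x" "\<forall>y\<in>set u. x \<le> y"
  shows "\<not> dumont u"
proof
  assume d: "dumont u"
  obtain i where i: "i < length u" "u ! i = x" using assms(1) by (auto simp: in_set_conv_nth)
  then have "Suc i < length u" "u ! Suc i < x" using d assms(2) by (auto simp: dumont_def)
  then show False using assms(3) by (meson leD nth_mem)
qed

text \<open>If \<open>a\<close> in \<open>u\<close> were below \<open>c\<close> in \<open>v\<close>,
  then \<open>a\<close>, \<open>N\<close>, \<open>c\<close> would be a 132. Conversely, an
  occurrence that meets both \<open>u\<close> and \<open>N # v\<close> has its smallest letter in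
  \<open>u\<close> and its last letter in \<open>N # v\<close>: a last letter in \<open>v\<close> is
  too small, and \<open>N\<close> leaves no larger middle letter.\<close>

lemma avoids_132_append_greatest:
  assumes "\<forall>x\<in>set u. x < N" "\<forall>x\<in>set v. x < N"
  shows "avoids_132 (u @ N # v) \<longleftrightarrow>
    avoids_132 u \<and> avoids_132 v \<and> (\<forall>a\<in>set u. \<forall>c\<in>set v. c \<le> a)"
proof
  assume A: "avoids_132 (u @ N # v)"
  have "c \<le> a" if ac: "a \<in> set u" "c \<in> set v" for a c
  proof -
    have "subseq ([a] @ N # [c]) (u @ N # v)"
      using ac by (intro list_emb_append_mono) (auto simp: subseq_singleton_left)
    moreover have "c < N" using assms ac by simp
    ultimately show ?thesis using A unfolding avoids_132_def
      by (metis append_Cons append_Nil not_le)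
  qed
  moreover have "avoids_132 u" "avoids_132 v"
    using A unfolding avoids_132_def
    by (meson list_emb_append2 list_emb_prefix list_emb_Cons)+
  ultimately show "avoids_132 u \<and> avoids_132 v \<and> (\<forall>a\<in>set u. \<forall>c\<in>set v. c \<le> a)" by blast
next
  assume A: "avoids_132 u \<and> avoids_132 v \<and> (\<forall>a\<in>set u. \<forall>c\<in>set v. c \<le> a)"
  show "avoids_132 (u @ N # v)"
    unfolding avoids_132_def
  proof (intro allI impI notI)
    fix a b c
    assume sub: "subseq [a, b, c] (u @ N # v)" and abc: "a < c \<and> c < b"
    from sub obtain s t where st: "[a, b, c] = s @ t" "subseq s u" "subseq t (N # v)"
      by (auto simp: subseq_append_iff)
    have su: "set s \<subseteq> set u" and tv: "set t \<subseteq> insert N (set v)"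
      using subseq_set_subset[OF st(2)] subseq_set_subset[OF st(3)] by auto
    show False
    proof (cases s)
      case Nil
      then have "subseq [a, b, c] (N # v)" using st by simp
      then have "a = N \<and> subseq [b, c] v \<or> subseq [a, b, c] v"
        by (auto split: if_splits)
      then show False
      proof
        assume "a = N \<and> subseq [b, c] v"
        then have "b < N" using assms(2) by (auto dest!: subseq_set_subset)
        then show False using \<open>a = N \<and> _\<close> abc by simp
      next
        assume "subseq [a, b, c] v"
        then show False using A abc unfolding avoids_132_def by blast
      qed
    next
      case (Cons x s')
      then have a: "a \<in> set u" using st su by auto
      show False
      proof (cases t)
        case Nil
        then have "subseq [a, b, c] u" using st by simp
        then show False using A abc unfolding avoids_132_def by blast
      next
        case (Cons y t')
        then have "c \<in> insert N (set v)"
          using st(1) tv by (metis last.simps last_appendR last_in_set list.distinct(1) subsetD)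
        moreover have "b \<in> insert N (set v) \<or> b \<in> set u"
          using st(1) su tv by (metis Un_iff list.set_intros set_append subsetD)
        then have "b \<le> N" using assms by (auto intro: less_imp_le)
        ultimately show False using a A abc by fastforce
      qed
    qed
  qed
qed

lemma has_increasing_mono:
  assumes "has_increasing k w" "l \<le> k"
  shows "has_increasing l w"
proof -
  obtain s where s: "subseq s w" "length s = k" "sorted_wrt (<) s"
    using assms by (auto simp: has_increasing_def)
  have "subseq (take l s) s"
    by (metis append_take_drop_id list_emb_prefix subseq_order.refl)
  then have "subseq (take l s) w" using s(1) subseq_order.trans by blast
  then show ?thesis using s assms(2)
    unfolding has_increasing_def by (intro exI[of _ "take l s"]) (auto intro: sorted_wrt_take)
qed

text \<open>An increasing subsequence can use \<open>N\<close> only as its last letter, and it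
  cannot pass from \<open>u\<close> to \<open>v\<close>, whose letters do not exceed those of
  \<open>u\<close>.\<close>

lemma has_increasing_append_greatest:
  assumes "\<forall>x\<in>set u. x < N" "\<forall>x\<in>set v. x < N" "\<forall>a\<in>set u. \<forall>c\<in>set v. c \<le> a"
  shows "has_increasing (Suc k) (u @ N # v) \<longleftrightarrow> has_increasing k u \<or> has_increasing (Suc k) v"
proof
  assume "has_increasing (Suc k) (u @ N # v)"
  then obtain s t where st: "subseq s u" "subseq t (N # v)" "length (s @ t) = Suc k"
    "sorted_wrt (<) (s @ t)"
    by (auto simp: has_increasing_def subseq_append_iff)
  show "has_increasing k u \<or> has_increasing (Suc k) v"
  proof (cases t)
    case Nil
    then have "has_increasing (Suc k) u" using st by (auto simp: has_increasing_def)
    \<comment> \<open>A subsequence lying wholly in \<open>u\<close> is one letter longer than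
      required.\<close>
    then show ?thesis using has_increasing_mono by auto
  next
    case (Cons y t')
    show ?thesis
    proof (cases "y = N")
      case True
      have "t' = []"
      proof (rule ccontr)
        assume "t' \<noteq> []"
        then obtain z where z: "z \<in> set t'" by (cases t') auto
        have "N < z" using st(4) Cons True z by (auto simp: sorted_wrt_append)
        moreover have "z \<in> set v" using st(2) Cons True z by (auto dest: subseq_set_subset)
        ultimately show False using assms(2) by auto
      qed
      then show ?thesis using st Cons by (auto simp: has_increasing_def sorted_wrt_append)
    next
      case False
      then have tv: "subseq t v" using st(2) Cons by (auto split: if_splits)
      then have y: "y \<in> set v" using Cons by (auto dest!: subseq_set_subset)
      have "s = []"
      proof (rule ccontr)
        assume "s \<noteq> []"
        then obtain z where z: "z \<in> set s" by (cases s) auto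
        have "z < y" using st(4) Cons z by (auto simp: sorted_wrt_append)
        moreover have "z \<in> set u" using st(1) z by (auto dest: subseq_set_subset)
        ultimately show False using assms(3) y by fastforce
      qed
      then show ?thesis using st tv by (auto simp: has_increasing_def)
    qed
  qed
next
  assume "has_increasing k u \<or> has_increasing (Suc k) v"
  then show "has_increasing (Suc k) (u @ N # v)"
  proof
    assume "has_increasing k u"
    then obtain s where s: "subseq s u" "length s = k" "sorted_wrt (<) s"
      by (auto simp: has_increasing_def)
    have "subseq (s @ [N]) (u @ N # v)"
      using s(1) by (intro list_emb_append_mono) auto
    moreover have "\<forall>x\<in>set s. x < N" using s(1) assms(1) by (auto dest: subseq_set_subset)
    ultimately show ?thesis using s
      unfolding has_increasing_def by (intro exI[of _ "s @ [N]"]) (auto simp: sorted_wrt_append)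
  next
    assume "has_increasing (Suc k) v"
    then show ?thesis
      unfolding has_increasing_def by (meson list_emb_append2 list_emb_Cons)
  qed
qed

section \<open>Invariance under adding a constant to all letters\<close>

lemma subseq_map_obtains:
  assumes "subseq s (map f u)"
  obtains t where "subseq t u" "s = map f t"
  using assms that by (auto simp: subseq_conv_nths nths_map)

lemma avoids_132_map_add: "avoids_132 (map (\<lambda>x. x + j) u) \<longleftrightarrow> avoids_132 u"
proof
  assume A: "avoids_132 (map (\<lambda>x. x + j) u)"
  show "avoids_132 u"
    unfolding avoids_132_def
  proof (intro allI impI)
    fix a b c assume "subseq [a, b, c] u"
    then have "subseq (map (\<lambda>x. x + j) [a, b, c]) (map (\<lambda>x. x + j) u)" by (rule subseq_map)
    then show "\<not> (a < c \<and> c < b)" using A unfolding avoids_132_def by fastforce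
  qed
next
  assume A: "avoids_132 u"
  show "avoids_132 (map (\<lambda>x. x + j) u)"
    unfolding avoids_132_def
  proof (intro allI impI)
    fix a b c assume "subseq [a, b, c] (map (\<lambda>x. x + j) u)"
    then obtain t where t: "subseq t u" "[a, b, c] = map (\<lambda>x. x + j) t"
      by (rule subseq_map_obtains)
    then show "\<not> (a < c \<and> c < b)" using A by (auto simp: avoids_132_def)
  qed
qed

lemma has_increasing_map_add: "has_increasing k (map (\<lambda>x. x + j) u) \<longleftrightarrow> has_increasing k u"
proof
  assume "has_increasing k (map (\<lambda>x. x + j) u)"
  then obtain s where s: "subseq s (map (\<lambda>x. x + j) u)" "length s = k" "sorted_wrt (<) s"
    by (auto simp: has_increasing_def)
  from s(1) obtain t where "subseq t u" "s = map (\<lambda>x. x + j) t"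
    by (rule subseq_map_obtains)
  then show "has_increasing k u" using s by (auto simp: has_increasing_def sorted_wrt_map)
next
  assume "has_increasing k u"
  then obtain s where s: "subseq s u" "length s = k" "sorted_wrt (<) s"
    by (auto simp: has_increasing_def)
  then show "has_increasing k (map (\<lambda>x. x + j) u)"
    unfolding has_increasing_def
    by (intro exI[of _ "map (\<lambda>x. x + j) s"]) (auto simp: sorted_wrt_map subseq_map)
qed

section \<open>Decomposition of the counted permutations\<close>

definition dumont_class :: "nat \<Rightarrow> nat \<Rightarrow> nat list set" where
  "dumont_class k n =
     {w \<in> permutations_of_set {1..n}. dumont w \<and> avoids_132 w \<and> \<not> has_increasing k w}"

lemma finite_dumont_class: "finite (dumont_class k n)"
  unfolding dumont_class_def by simp

text \<open>The empty subsequence is increasing of length 0, so every word is excluded; this matches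
  \<open>F 0 = 0\<close>.\<close>

lemma dumont_class_0: "dumont_class 0 n = {}"
  by (auto simp: dumont_class_def has_increasing_def)

lemma dumont_class_Suc_0: "dumont_class (Suc k) 0 = {[]}"
  by (auto simp: dumont_class_def has_increasing_def dumont_def avoids_132_def)

text \<open>The letters after the greatest one are the smallest letters, hence exactly
  \<open>{1..b}\<close> with \<open>b\<close> their number. Those before it are
  \<open>{Suc b..n}\<close> and become a permutation after subtracting \<open>b\<close>.\<close>

lemma avoids_132_decompose:
  assumes "w \<in> permutations_of_set {1..Suc n}" "avoids_132 w"
  obtains b u v where "b \<le> n" "u \<in> permutations_of_set {1..n - b}" "v \<in> permutations_of_set {1..b}"
    "w = map (\<lambda>x. x + b) u @ Suc n # v"
proof -
  have w: "set w = {1..Suc n}" "distinct w" using assms(1) by (auto simp: permutations_of_set_def)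
  then have "Suc n \<in> set w" by simp
  then obtain p v where pv: "w = p @ Suc n # v" by (meson split_list)
  have "Suc n \<notin> set p \<union> set v" "distinct p" "distinct v" and disj: "set p \<inter> set v = {}"
    using w(2) pv by auto
  have "set p \<union> set v = set w - {Suc n}" using pv \<open>Suc n \<notin> set p \<union> set v\<close> by auto
  then have un: "set p \<union> set v = {1..n}" using w(1) by auto
  have mem: "x \<in> set p \<or> x \<in> set v \<longleftrightarrow> 1 \<le> x \<and> x \<le> n" for x
    using un by (metis Un_iff atLeastAtMost_iff)
  have ge: "\<forall>a\<in>set p. \<forall>c\<in>set v. c \<le> a"
  proof -
    have "\<forall>x\<in>set p. x < Suc n" "\<forall>x\<in>set v. x < Suc n" using mem by (meson le_imp_less_Suc)+
    then show ?thesis using avoids_132_append_greatest assms(2) pv by blast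
  qed
  define b where "b = length v"
  have b: "card (set v) = b" using \<open>distinct v\<close> by (simp add: b_def distinct_card)
  \<comment> \<open>The set of letters of \<open>v\<close> is downward closed: a letter of
    \<open>p\<close> that is at most \<open>c\<close> would have to equal \<open>c\<close>. Counting
    \<open>{1..c}\<close> then bounds \<open>c\<close>.\<close>
  have "c \<le> b" if c: "c \<in> set v" for c
  proof -
    have "{1..c} \<subseteq> set v"
    proof
      fix x assume x: "x \<in> {1..c}"
      then have "x \<in> set p \<or> x \<in> set v"
        using mem c by (meson atLeastAtMost_iff le_trans)
      then show "x \<in> set v" using ge c x by fastforce
    qed
    then have "card {1..c} \<le> card (set v)" by (intro card_mono) auto
    then show ?thesis using b by simp
  qed
  then have "set v \<subseteq> {1..b}" using mem by (meson atLeastAtMost_iff subsetI)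
  then have sv: "set v = {1..b}" using b by (intro card_subset_eq) auto
  have "b \<le> n"
  proof -
    have "card (set v) \<le> card {1..n}" using un by (intro card_mono) blast+
    then show ?thesis using b by simp
  qed
  have "set p = {1..n} - {1..b}" using un sv disj by blast
  also have "\<dots> = {Suc b..n}" by auto
  finally have sp: "set p = {Suc b..n}" .
  \<comment> \<open>All letters of \<open>p\<close> exceed \<open>b\<close>, so the truncated
    subtraction is undone by adding \<open>b\<close> again.\<close>
  define u where "u = map (\<lambda>x. x - b) p"
  have pu: "p = map (\<lambda>x. x + b) u"
    using sp by (auto simp: u_def comp_def intro!: map_idI[symmetric])
  have "set u = {1..n - b}"
  proof -
    have "(\<lambda>x. x + b) ` set u = (\<lambda>x. x + b) ` {1..n - b}"
      using sp pu \<open>b \<le> n\<close>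
      by (metis image_add_atLeastAtMost' image_set le_add_diff_inverse2 plus_1_eq_Suc)
    then show ?thesis by (rule inj_image_eq_iff[THEN iffD1, rotated]) simp
  qed
  moreover have "distinct u" using \<open>distinct p\<close> pu by (simp add: distinct_map)
  ultimately show thesis
    using that[of b u v] \<open>b \<le> n\<close> sv \<open>distinct v\<close> pv pu by (auto simp: permutations_of_set_def)
qed

lemma glue_mem_permutations:
  assumes "b \<le> n" "u \<in> permutations_of_set {1..n - b}" "v \<in> permutations_of_set {1..b}"
  shows "map (\<lambda>x. x + b) u @ Suc n # v \<in> permutations_of_set {1..Suc n}"
proof -
  have "(\<lambda>x. x + b) ` {1..n - b} = {Suc b..n}"
    using assms(1) by (simp add: image_add_atLeastAtMost')
  then have s: "set (map (\<lambda>x. x + b) u) = {Suc b..n}"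
    using assms(2) by (simp add: permutations_of_set_def)
  then show ?thesis
    using assms unfolding permutations_of_set_def by (auto simp: distinct_map simp del: set_map)
qed

text \<open>
  If \<open>b\<close> is odd, the least letter \<open>b + 1\<close> of a nonempty left part would be even but not followed
  by a smaller letter; this is why the left part is then empty.
\<close>

lemma glue_mem_dumont_class_iff:
  assumes "b \<le> n" "u \<in> permutations_of_set {1..n - b}" "v \<in> permutations_of_set {1..b}"
  shows "map (\<lambda>x. x + b) u @ Suc n # v \<in> dumont_class (Suc k) (Suc n) \<longleftrightarrow>
    u \<in> dumont_class k (n - b) \<and> v \<in> dumont_class (Suc k) b \<and>
    (if even b then odd n \<longleftrightarrow> b \<noteq> 0 else b = n)"
proof -
  have su: "set u = {1..n - b}" and sv: "set v = {1..b}"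
    using assms by (auto simp: permutations_of_set_def)
  let ?u = "map (\<lambda>x. x + b) u"
  have lt: "\<forall>x\<in>set ?u. x < Suc n" "\<forall>x\<in>set v. x < Suc n" "\<forall>a\<in>set ?u. \<forall>c\<in>set v. c \<le> a"
    using su sv assms(1) by auto
  have v: "v = [] \<longleftrightarrow> b = 0" using sv by auto
  have "dumont ?u \<longleftrightarrow> dumont u \<and> (even b \<or> b = n)"
  proof (cases "even b")
    case True
    then show ?thesis by (simp add: dumont_map_add_even)
  next
    case False
    show ?thesis
    proof (cases "b = n")
      case True
      then have "u = []" using su by auto
      then show ?thesis using True by simp
    next
      case neq: False
      have "\<not> dumont ?u"
      proof (rule not_dumont_least_even)
        show "Suc b \<in> set ?u" using su neq assms(1) by force
        show "even (Suc b)" using False by simp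
        show "\<forall>y\<in>set ?u. Suc b \<le> y" using su by auto
      qed
      then show ?thesis using False neq by simp
    qed
  qed
  \<comment> \<open>The parity condition at \<open>Suc n\<close> has \<open>v\<close> nonempty iff
    \<open>b\<close> is nonzero. It holds automatically when \<open>b = n\<close> is odd, and for
    even \<open>b\<close> it is what the first branch of the conditional states.\<close>
  then show ?thesis
    using glue_mem_permutations[OF assms] assms(2,3) v
    unfolding dumont_class_def
    by (auto simp: dumont_append_greatest[OF lt(1,2)] avoids_132_append_greatest[OF lt(1,2)]
        has_increasing_append_greatest[OF lt] avoids_132_map_add has_increasing_map_add
        lt(3)[simplified])
qed

section \<open>Recurrences for the numbers of permutations\<close>

lemma card_dumont_class_Suc_Suc:
  "card (dumont_class (Suc k) (Suc n)) =
    (\<Sum>b \<in> {b. b \<le> n \<and> (if even b then odd n \<longleftrightarrow> b \<noteq> 0 else b = n)}.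
      card (dumont_class k (n - b)) * card (dumont_class (Suc k) b))"
proof -
  define B where "B = {b. b \<le> n \<and> (if even b then odd n \<longleftrightarrow> b \<noteq> 0 else b = n)}"
  define S where "S = (SIGMA b:B. dumont_class k (n - b) \<times> dumont_class (Suc k) b)"
  define g where "g = (\<lambda>(b, u, v). map (\<lambda>x. x + b) u @ Suc n # v)"
  have "dumont_class (Suc k) (Suc n) = g ` S"
  proof (intro subset_antisym subsetI)
    fix w assume w: "w \<in> dumont_class (Suc k) (Suc n)"
    then have "w \<in> permutations_of_set {1..Suc n}" "avoids_132 w"
      by (auto simp: dumont_class_def)
    then obtain b u v where
      buv: "b \<le> n" "u \<in> permutations_of_set {1..n - b}" "v \<in> permutations_of_set {1..b}"
      "w = map (\<lambda>x. x + b) u @ Suc n # v" by (rule avoids_132_decompose)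
    then have "(b, u, v) \<in> S"
      using w glue_mem_dumont_class_iff[OF buv(1-3), of k] by (auto simp: S_def B_def)
    then show "w \<in> g ` S" using buv(4) by (force simp: g_def)
  next
    fix w assume "w \<in> g ` S"
    then obtain b u v where
      buv: "b \<in> B" "u \<in> dumont_class k (n - b)" "v \<in> dumont_class (Suc k) b"
      "w = map (\<lambda>x. x + b) u @ Suc n # v" by (auto simp: S_def g_def)
    moreover have "b \<le> n" "u \<in> permutations_of_set {1..n - b}" "v \<in> permutations_of_set {1..b}"
      using buv by (auto simp: B_def dumont_class_def)
    ultimately show "w \<in> dumont_class (Suc k) (Suc n)"
      using glue_mem_dumont_class_iff[of b n u v k] by (auto simp: B_def)
  qed
  moreover have "inj_on g S"
  proof (rule inj_onI)
    fix x y assume xy: "x \<in> S" "y \<in> S" "g x = g y"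
    obtain b u v where x: "x = (b, u, v)" by (cases x) auto
    obtain b' u' v' where y: "y = (b', u', v')" by (cases y) auto
    have set_x: "set u = {1..n - b}" "set v = {1..b}" "distinct v" "b \<le> n"
      and set_y: "set v' = {1..b'}" "distinct v'"
      using xy x y by (auto simp: S_def B_def dumont_class_def permutations_of_set_def)
    \<comment> \<open>Injectivity of the gluing: the unique \<open>Suc n\<close> determines the two
      factors, and the letters of the right factor determine \<open>b\<close>.\<close>
    have "Suc n \<notin> set (map (\<lambda>x. x + b) u)" "Suc n \<notin> set v" using set_x by auto
    then have eq: "map (\<lambda>x. x + b) u = map (\<lambda>x. x + b') u'" "v = v'"
      using xy(3) x y by (auto simp: g_def append_Cons_eq_iff)
    have "card {1..b} = card {1..b'}" using set_x(2) set_y(1) eq(2) by metis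
    then have "b = b'" by simp
    moreover from this have "u = u'"
      using eq(1) by (metis (no_types, lifting) add_right_cancel inj_def inj_map_eq_map)
    ultimately show "x = y" using x y eq by simp
  qed
  ultimately have "card (dumont_class (Suc k) (Suc n)) = card S" by (simp add: card_image)
  moreover have "finite B" unfolding B_def by simp
  ultimately show ?thesis
    unfolding S_def B_def[symmetric]
    by (simp add: card_SigmaI finite_dumont_class card_cartesian_product)
qed

text \<open>For odd length \<open>Suc n\<close> only \<open>b = 0\<close> is admissible, so the
  greatest letter stands last and removing it lowers the forbidden length by one.\<close>

lemma card_dumont_class_odd:
  assumes "even n"
  shows "card (dumont_class (Suc k) (Suc n)) = card (dumont_class k n)"
proof -
  have "{b. b \<le> n \<and> (if even b then odd n \<longleftrightarrow> b \<noteq> 0 else b = n)} = {0}"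
    using assms by auto
  then show ?thesis by (simp add: card_dumont_class_Suc_Suc dumont_class_Suc_0)
qed

text \<open>The first summand comes from \<open>b = Suc n\<close>, where the left part is empty and
  the right part has odd length. For the other \<open>b\<close> the left part has odd length
  \<open>Suc n - b\<close>. In both cases \<open>card_dumont_class_odd\<close> removes one more
  letter, which is why two lower indices appear.\<close>

lemma card_dumont_class_even:
  assumes "even n"
  shows "card (dumont_class (Suc (Suc k)) (Suc (Suc n))) = card (dumont_class (Suc k) n) +
    (\<Sum>b \<in> {b. b \<le> n \<and> even b \<and> b \<noteq> 0}.
      card (dumont_class k (n - b)) * card (dumont_class (Suc (Suc k)) b))"
proof -
  have "{b. b \<le> Suc n \<and> (if even b then odd (Suc n) \<longleftrightarrow> b \<noteq> 0 else b = Suc n)} =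
      insert (Suc n) {b. b \<le> n \<and> even b \<and> b \<noteq> 0}"
    using assms by (auto simp: le_Suc_eq)
  moreover have "(\<Sum>b \<in> {b. b \<le> n \<and> even b \<and> b \<noteq> 0}.
        card (dumont_class (Suc k) (Suc n - b)) * card (dumont_class (Suc (Suc k)) b)) =
      (\<Sum>b \<in> {b. b \<le> n \<and> even b \<and> b \<noteq> 0}.
        card (dumont_class k (n - b)) * card (dumont_class (Suc (Suc k)) b))"
    using assms by (intro sum.cong) (auto simp: Suc_diff_le card_dumont_class_odd)
  ultimately show ?thesis
    using card_dumont_class_odd[OF assms, of "Suc k"]
    unfolding card_dumont_class_Suc_Suc[of "Suc k" "Suc n"]
    by (simp add: dumont_class_Suc_0)
qed

section \<open>Generating functions\<close>

unbundle fps_syntax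

definition even_gf :: "nat \<Rightarrow> rat fps" where
  "even_gf k = Abs_fps (\<lambda>n. if even n then of_nat (card (dumont_class k n)) else 0)"

text \<open>Subtracting 1 removes the empty word, matching the restriction to nonzero
  \<open>b\<close> in \<open>card_dumont_class_even\<close>; the sum there is then a Cauchy product,
  and the two extra letters give the factor \<open>fps_X\<^sup>2\<close>.\<close>

lemma even_gf_recurrence:
  "even_gf (Suc (Suc k)) - 1 =
    fps_X\<^sup>2 * even_gf (Suc k) + fps_X\<^sup>2 * ((even_gf (Suc (Suc k)) - 1) * even_gf k)"
proof (rule fps_ext)
  fix n
  let ?E = "even_gf (Suc (Suc k)) - 1"
  consider "n = 0" | "n = 1" | m where "n = Suc (Suc m)"
    by (metis One_nat_def not0_implies_Suc)
  then show "?E $ n = (fps_X\<^sup>2 * even_gf (Suc k) + fps_X\<^sup>2 * (?E * even_gf k)) $ n"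
  proof cases
    case 1
    then show ?thesis by (simp add: even_gf_def dumont_class_Suc_0 fps_X_power_mult_nth)
  next
    case 2
    then show ?thesis by (simp add: even_gf_def fps_X_power_mult_nth)
  next
    case (3 m)
    have E: "?E $ b =
        (if even b \<and> b \<noteq> 0 then of_nat (card (dumont_class (Suc (Suc k)) b)) else 0)" for b
      by (simp add: even_gf_def dumont_class_Suc_0)
    have prod: "(?E * even_gf k) $ m = (\<Sum>b=0..m. ?E $ b * even_gf k $ (m - b))"
      by (rule fps_mult_nth)
    show ?thesis
    proof (cases "even m")
      case True
      have "(?E * even_gf k) $ m = (\<Sum>b \<in> {b. b \<le> m \<and> even b \<and> b \<noteq> 0}.
          of_nat (card (dumont_class k (m - b)) * card (dumont_class (Suc (Suc k)) b)))"
        unfolding prod E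
        \<comment> \<open>The terms with \<open>b\<close> odd or zero vanish.\<close>
        by (intro sum.mono_neutral_cong_right) (use True in \<open>auto simp: even_gf_def\<close>)
      then show ?thesis
        using 3 True
        by (simp add: fps_X_power_mult_nth even_gf_def card_dumont_class_even del: of_nat_mult)
    next
      case False
      \<comment> \<open>For odd \<open>m\<close> one of \<open>b\<close> and \<open>m - b\<close> is
        odd, and its factor vanishes.\<close>
      then have "?E $ b * even_gf k $ (m - b) = 0" if "b \<in> {0..m}" for b
        using that unfolding E by (auto simp: even_gf_def)
      then have "(?E * even_gf k) $ m = 0" unfolding prod by (intro sum.neutral) blast
      then show ?thesis
        using 3 False by (simp add: fps_X_power_mult_nth even_gf_def)
    qed
  qed
qed

lemma even_gf_eq_F: "even_gf k = F k"
proof (induction k rule: F.induct)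
  case 1
  show ?case by (rule fps_ext) (simp add: even_gf_def dumont_class_0)
next
  case 2
  show ?case
  proof (rule fps_ext)
    fix n
    show "even_gf (Suc 0) $ n = F (Suc 0) $ n"
    proof (cases n)
      case 0
      then show ?thesis by (simp add: even_gf_def dumont_class_Suc_0)
    next
      case (Suc m)
      \<comment> \<open>Each product in the recurrence has a factor from the empty class of index 0,
        so only the empty word is counted.\<close>
      then show ?thesis by (simp add: even_gf_def card_dumont_class_Suc_Suc dumont_class_0)
    qed
  qed
next
  case (3 r)
  let ?q = "1 - fps_X\<^sup>2 * F r"
  \<comment> \<open>The constant coefficient is 1, so \<open>?q\<close> is nonzero and may be
    cancelled.\<close>
  have q: "?q $ 0 \<noteq> 0" by (simp add: fps_X_power_mult_nth)
  then have "?q \<noteq> 0" by force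
  have "(even_gf (Suc (Suc r)) - 1) * ?q = fps_X\<^sup>2 * F (Suc r)"
    using even_gf_recurrence[of r] 3 by (simp add: algebra_simps)
  then have "even_gf (Suc (Suc r)) - 1 = fps_X\<^sup>2 * F (Suc r) / ?q"
    using \<open>?q \<noteq> 0\<close> by (metis nonzero_mult_div_cancel_right)
  then show ?case by (simp add: algebra_simps)
qed

section \<open>Both patterns count the same class\<close>

lemma dumont_count_classical_increasing:
  "dumont_count (classical_increasing k) n = card (dumont_class k n)"
  by (simp add: dumont_count_def dumont_class_def avoids_pattern_132_iff
      avoids_classical_increasing_iff)

lemma dumont_count_adjacent_increasing:
  assumes "k \<ge> 1"
  shows "dumont_count (adjacent_increasing k) n = card (dumont_class k n)"
proof -
  have "{w \<in> permutations_of_set {1..n}. dumont w \<and> avoids w pattern_132 \<and>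
      avoids w (adjacent_increasing k)} = dumont_class k n"
    using avoids_adjacent_increasing_iff[OF _ _ assms]
    by (auto simp: dumont_class_def avoids_pattern_132_iff permutations_of_set_def)
  then show ?thesis by (simp add: dumont_count_def)
qed

theorem theorem2p10:
  fixes k :: nat
  assumes "k \<ge> 1"
  shows "dumont_gf (adjacent_increasing k) = dumont_gf (classical_increasing k) \<and>
         dumont_gf (classical_increasing k) = F k + fps_X * F (k - 1)"
proof
  show "dumont_gf (adjacent_increasing k) = dumont_gf (classical_increasing k)"
    using assms by (simp add: dumont_gf_def dumont_count_adjacent_increasing
        dumont_count_classical_increasing)
  obtain l where k: "k = Suc l" using assms by (cases k) auto
  show "dumont_gf (classical_increasing k) = F k + fps_X * F (k - 1)"
  proof (rule fps_ext)
    fix n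
    show "dumont_gf (classical_increasing k) $ n = (F k + fps_X * F (k - 1)) $ n"
      \<comment> \<open>Only one summand contributes to each coefficient: \<open>F k\<close> for
        even \<open>n\<close>, and \<open>fps_X * F (k - 1)\<close> for odd \<open>n\<close> by
        \<open>card_dumont_class_odd\<close>.\<close>
      by (cases n) (auto simp: k dumont_gf_def dumont_count_classical_increasing even_gf_def
          card_dumont_class_odd simp flip: even_gf_eq_F)
  qed
qed

end
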